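(* For every positive integer $n$, let $$R_n=\{\omega\in\{1,2\}^*_n \mid \lambda=\lambda(\omega),\ \lambda_1\le n-N_\omega(1),\ N_\omega(1)-1\le d(\lambda)\le N_\omega(1),\ B(\lambda)=\emptyset\}$$ and $$R'_n=\{\omega\in\{1,2\}^*_n \mid \lambda=\lambda(\omega),\ \lambda_1= n-N_\omega(1),\ N_\omega(1)-1\le d(\lambda)\le N_\omega(1),\ B(\lambda)=\emptyset\}.$$ Then $(F_n,R_n)$ and $(F'_n,R'_n)$ are Eulerian pairs.
   Context: $\{1,2\}^*_n$ denotes the set of words of length $n$ on the alphabet $\{1,2\}$ (binary words). For a word $\omega=a_1a_2\cdots a_n$ of positive integers, $\mathrm{des}(\omega)=\#\{i : 1\le i\le n-1,\ a_i>a_{i+1}\}$; and if $x_1\le x_2\le\cdots\le x_n$ is the nondecreasing rearrangement of the letters of $\omega$ (so $\omega$ is written in two-line form with top row $x_1\cdots x_n$ and bottom row $a_1\cdots a_n$), then $\mathrm{exc}(\omega)=\#\{i: a_i>x_i\}$. For finite sets $S,T$ of words, $(S,T)$ is an Eulerian pair if for every integer $j$, $\#\{\omega\in S:\mathrm{des}(\omega)=j\}=\#\{\omega\in T:\mathrm{exc}(\omega)=j\}$. A Fibonacci word is a word on $\{1,2\}$ with no two consecutive $1$'s; $F_n$ is the set of Fibonacci words of length $n$ and $F'_n$ the set of those ending with $1$. $N_\omega(1)$ is the number of $1$'s in $\omega$. For a binary word $\omega$, $\lambda(\omega)$ is the integer partition whose parts are the positive values among the numbers $c_1,\dots,c_{N_\omega(1)}$,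 where $c_r$ is the number of $2$'s to the left of the $r$-th occurrence of $1$ in $\omega$ (parts listed in weakly decreasing order $\lambda_1\ge\lambda_2\ge\cdots\ge\lambda_k>0$, $k=l(\lambda)$; $\lambda_1=0$ if $\lambda$ is empty). The Durfee square size $d(\lambda)$ is the largest integer $i\le l(\lambda)$ with $\lambda_i\ge i$, and $B(\lambda)=(\lambda_{d(\lambda)+1},\ldots,\lambda_k)$. *)

theory Defs
  imports Main
begin

text \<open>Words of positive integers are lists of naturals. List positions are counted from 0,
  whereas parts of partitions are indexed from 1 as usual, so \<open>\<lambda>\<^sub>i\<close> is \<open>lam ! (i - 1)\<close>.\<close>

definition binary_words :: "nat \<Rightarrow> nat list set" where
  "binary_words n = {w. length w = n \<and> set w \<subseteq> {1, 2}}"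

definition des :: "nat list \<Rightarrow> nat" where
  "des w = card {i. i + 1 < length w \<and> w ! i > w ! (i + 1)}"

definition exc :: "nat list \<Rightarrow> nat" where
  "exc w = card {i. i < length w \<and> w ! i > sort w ! i}"

definition eulerian_pair :: "nat list set \<Rightarrow> nat list set \<Rightarrow> bool" where
  "eulerian_pair S T \<longleftrightarrow> finite S \<and> finite T \<and>
     (\<forall>j::int. card {w \<in> S. int (des w) = j} = card {w \<in> T. int (exc w) = j})"

definition fib_words :: "nat \<Rightarrow> nat list set" where
  "fib_words n = {w \<in> binary_words n.
     \<not> (\<exists>i. i + 1 < length w \<and> w ! i = 1 \<and> w ! (i + 1) = 1)}"

definition fib_words' :: "nat \<Rightarrow> nat list set" where
  "fib_words' n = {w \<in> fib_words n. w \<noteq> [] \<and> last w = 1}"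

definition twos_left :: "nat list \<Rightarrow> nat list" where
  "twos_left w = map (\<lambda>i. count_list (take i w) 2) (filter (\<lambda>i. w ! i = 1) [0..<length w])"

definition word_partition :: "nat list \<Rightarrow> nat list" where
  "word_partition w = rev (sort (filter (\<lambda>c. c > 0) (twos_left w)))"

definition first_part :: "nat list \<Rightarrow> nat" where
  "first_part lam = (if lam = [] then 0 else lam ! 0)"

text \<open>The value \<open>i = 0\<close> is always admitted, so the empty partition has Durfee square size 0.\<close>

definition durfee :: "nat list \<Rightarrow> nat" where
  "durfee lam = Max {i. i \<le> length lam \<and> (i = 0 \<or> lam ! (i - 1) \<ge> i)}"

definition below_durfee :: "nat list \<Rightarrow> nat list" where
  "below_durfee lam = drop (durfee lam) lam"

definition R_words :: "nat \<Rightarrow> nat list set" where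
  "R_words n = {w \<in> binary_words n. let lam = word_partition w; N = count_list w 1 in
     int (first_part lam) \<le> int n - int N \<and>
     int N - 1 \<le> int (durfee lam) \<and> durfee lam \<le> N \<and>
     below_durfee lam = []}"

definition R_words' :: "nat \<Rightarrow> nat list set" where
  "R_words' n = {w \<in> binary_words n. let lam = word_partition w; N = count_list w 1 in
     int (first_part lam) = int n - int N \<and>
     int N - 1 \<le> int (durfee lam) \<and> durfee lam \<le> N \<and>
     below_durfee lam = []}"

end

theory Submission
  imports Defs
begin

text \<open>
  Both sides are parametrised by pairs of a prefix \<open>p\<close>, empty or a single \<open>1\<close>, and an arbitrary binary
  word \<open>u\<close> such that \<open>p\<close>, \<open>u\<close> and the ones of \<open>u\<close> together count \<open>n\<close>. A Fibonacci word is \<open>p\<close> followed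
  by \<open>u\<close> with every \<open>1\<close> replaced by \<open>21\<close>. On the other side, the excedances of a binary word with
  \<open>N\<close> ones are the twos among its first \<open>N\<close> letters, and \<open>B(\<lambda>) = \<emptyset>\<close> says that all parts of \<open>\<lambda>\<close> are at
  least \<open>l(\<lambda>)\<close>; since at most one of the \<open>N\<close> numbers \<open>c\<^sub>r\<close> may vanish, the word is \<open>p\<close> followed by
  as many twos as \<open>u\<close> has ones, followed by \<open>u\<close>. Both statistics count the ones of \<open>u\<close>, and both words end
  like \<open>p @ u\<close>.
\<close>

lemma count_list_one_two:
  assumes "set w \<subseteq> {1, 2::nat}"
  shows "count_list w 1 + count_list w 2 = length w"
  using assms by (induction w) auto

lemma count_list_replicate: "count_list (replicate k x) y = (if x = y then k else 0)"
  by (induction k) auto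

section \<open>Fibonacci words\<close>

definition expand :: "nat list \<Rightarrow> nat list" where
  "expand u = concat (map (\<lambda>x. if x = 1 then [2, 1] else [2]) u)"

lemma expand_simps [simp]:
  "expand [] = []"
  "expand (Suc 0 # u) = 2 # 1 # expand u"
  "expand (2 # u) = 2 # expand u"
  "expand (u @ v) = expand u @ expand v"
  by (simp_all add: expand_def)

lemma hd_expand: "expand u \<noteq> [] \<Longrightarrow> hd (expand u) = 2"
  by (cases u) (auto simp: expand_def)

lemma expand_neq_Cons_one [simp]: "expand u \<noteq> Suc 0 # v" "Suc 0 # v \<noteq> expand u"
  using hd_expand[of u] by (metis list.distinct(1) list.sel(1) n_not_Suc_n numeral_2_eq_2)+

lemma set_expand: "set (expand u) \<subseteq> {1, 2}"
  by (auto simp: expand_def)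

lemma length_expand: "length (expand u) = length u + count_list u 1"
  by (induction u) (auto simp: expand_def)

text \<open>The blocks \<open>21\<close> and \<open>2\<close> both start with 2, so the letter after
  a 2 reveals which block was used: a 1 there can never start the next block.\<close>

lemma expand_inj:
  assumes "set u \<subseteq> {1, 2}" "set v \<subseteq> {1, 2}" "expand u = expand v"
  shows "u = v"
  using assms
proof (induction u arbitrary: v)
  case Nil
  then show ?case by (cases v) (auto simp: expand_def)
next
  case (Cons x u)
  from Cons.prems obtain y v' where v: "v = y # v'" by (cases v) (auto simp: expand_def)
  have "x = 1 \<or> x = 2" "y = 1 \<or> y = 2" using Cons.prems v by auto
  then have "x = y \<and> expand u = expand v'" using Cons.prems(3) v by (elim disjE) simp_all
  moreover have "set u \<subseteq> {1, 2}" "set v' \<subseteq> {1, 2}" using Cons.prems v by simp_all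
  ultimately show ?case using Cons.IH v by blast
qed

lemma expand_eq_Nil_iff [simp]: "expand u = [] \<longleftrightarrow> u = []"
  by (cases u) (auto simp: expand_def)

lemma last_expand:
  assumes "set u \<subseteq> {1, 2}" "u \<noteq> []"
  shows "last (expand u) = last u"
  using assms by (cases u rule: rev_cases) auto

section \<open>Descents and avoidance of \<open>11\<close> in expanded words\<close>

lemma des_Nil [simp]: "des [] = 0"
  by (simp add: des_def)

lemma des_single [simp]: "des [x] = 0"
  by (simp add: des_def)

lemma des_Cons_Cons [simp]: "des (x # y # w) = (if x > y then 1 else 0) + des (y # w)"
proof -
  let ?D = "\<lambda>w :: nat list. {i. i + 1 < length w \<and> w ! i > w ! (i + 1)}"
  have "?D (x # y # w) = (if x > y then {0} else {}) \<union> Suc ` ?D (y # w)"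
    (is "?L = ?R")
  proof (rule set_eqI)
    fix i show "i \<in> ?L \<longleftrightarrow> i \<in> ?R" by (cases i) auto
  qed
  moreover have "finite (?D (y # w))" by (rule finite_subset[of _ "{..<length (y # w)}"]) auto
  ultimately show ?thesis
    by (auto simp: des_def card_image card_insert_disjoint)
qed

text \<open>The only descents lie inside the blocks \<open>21\<close>. Since a nonempty expansion
  starts with 2, a letter put in front of it creates no descent; the three claims are proved
  together because peeling a block leaves its last letter in front.\<close>

lemma des_expand_aux:
  assumes "set u \<subseteq> {1, 2}"
  shows "des (expand u) = count_list u 1 \<and> des (1 # expand u) = count_list u 1
    \<and> des (2 # expand u) = count_list u 1"
  using assms
proof (induction u)
  case (Cons x u)
  then show ?case by (cases "expand u") auto
qed simp

lemma des_append_expand: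
  assumes "set u \<subseteq> {1, 2}" "p = [] \<or> p = [1]"
  shows "des (p @ expand u) = count_list u 1"
  using des_expand_aux[OF assms(1)] assms(2) by auto

lemma no_11_Cons_Cons:
  "(\<exists>i. i + 1 < length (x # y # w) \<and> (x # y # w) ! i = 1 \<and> (x # y # w) ! (i + 1) = 1) \<longleftrightarrow>
    x = (1::nat) \<and> y = 1 \<or> (\<exists>i. i + 1 < length (y # w) \<and> (y # w) ! i = 1 \<and> (y # w) ! (i + 1) = 1)"
  (is "?L \<longleftrightarrow> ?R")
proof
  assume ?L
  then obtain i where "i + 1 < length (x # y # w)" "(x # y # w) ! i = 1" "(x # y # w) ! (i + 1) = 1"
    by blast
  then show ?R by (cases i) auto
next
  assume ?R
  then show ?L
  proof
    assume "x = 1 \<and> y = 1"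
    then show ?L by (intro exI[of _ 0]) auto
  next
    assume "\<exists>i. i + 1 < length (y # w) \<and> (y # w) ! i = 1 \<and> (y # w) ! (i + 1) = 1"
    then obtain i where "i + 1 < length (y # w)" "(y # w) ! i = 1" "(y # w) ! (i + 1) = 1"
      by blast
    then show ?L by (intro exI[of _ "Suc i"]) auto
  qed
qed

definition fib :: "nat list \<Rightarrow> bool" where
  "fib w \<longleftrightarrow> \<not> (\<exists>i. i + 1 < length w \<and> w ! i = 1 \<and> w ! (i + 1) = 1)"

lemma fib_simps [simp]:
  "fib []" "fib [x]" "fib (x # y # w) \<longleftrightarrow> \<not> (x = 1 \<and> y = 1) \<and> fib (y # w)"
  unfolding fib_def no_11_Cons_Cons by auto

lemma fib_expand_aux: "fib (expand u) \<and> fib (1 # expand u) \<and> fib (2 # expand u)"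
proof (induction u)
  case (Cons x u)
  then show ?case by (cases "expand u") (auto simp: expand_def)
qed simp

text \<open>Blocks are split off greedily from the left. After a block \<open>21\<close> the absence
  of \<open>11\<close> makes the rest empty or start with 2 again; blocks have one or two letters,
  hence induction on length.\<close>

lemma fib_imp_expand:
  assumes "set w \<subseteq> {1, 2}" "fib w" "w = [] \<or> hd w = 2"
  shows "\<exists>u. set u \<subseteq> {1, 2} \<and> w = expand u"
  using assms
proof (induction w rule: length_induct)
  case (1 w)
  show ?case
  proof (cases w)
    case Nil
    then show ?thesis by (intro exI[of _ "[]"]) auto
  next
    case w: (Cons x v)
    with 1 have x: "x = 2" by auto
    show ?thesis
    proof (cases "v = [] \<or> hd v = 2")
      case True
      moreover have "fib v" using 1 w by (cases v) auto
      ultimately obtain u where "set u \<subseteq> {1, 2}" "v = expand u"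
        using 1(1)[rule_format, of v] 1(2) w by auto
      with w x show ?thesis by (intro exI[of _ "2 # u"]) auto
    next
      case False
      then obtain v' where v: "v = 1 # v'" using 1(2) w by (cases v) auto
      have "fib v'" "v' = [] \<or> hd v' = 2" using 1 w v by (cases v'; auto)+
      then obtain u where "set u \<subseteq> {1, 2}" "v' = expand u"
        using 1(1)[rule_format, of v'] 1(2) w v by auto
      with w x v show ?thesis by (intro exI[of _ "1 # u"]) auto
    qed
  qed
qed

section \<open>The common parameter set and its image in the Fibonacci words\<close>

definition params :: "nat \<Rightarrow> (nat list \<times> nat list) set" where
  "params n = {(p, u). (p = [] \<or> p = [1]) \<and> set u \<subseteq> {1, 2} \<and> length p + length u + count_list u 1 = n}"

lemma finite_params: "finite (params n)"
proof (rule finite_subset)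
  show "params n \<subseteq> {[], [1]} \<times> {u. set u \<subseteq> {1, 2} \<and> length u \<le> n}"
    by (auto simp: params_def)
  show "finite ({[], [1]} \<times> {u. set u \<subseteq> {1, 2::nat} \<and> length u \<le> n})"
    using finite_lists_length_le[of "{1, 2::nat}" n] by simp
qed

definition to_fib :: "nat list \<times> nat list \<Rightarrow> nat list" where
  "to_fib = (\<lambda>(p, u). p @ expand u)"

lemma inj_on_to_fib: "inj_on to_fib (params n)"
proof (rule inj_onI, clarify)
  fix p u q v
  assume "(p, u) \<in> params n" "(q, v) \<in> params n" and eq: "to_fib (p, u) = to_fib (q, v)"
  then have *: "p = [] \<or> p = [1]" "q = [] \<or> q = [1]" "set u \<subseteq> {1, 2}" "set v \<subseteq> {1, 2}"
    by (simp_all add: params_def)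
  have "p = q \<and> expand u = expand v"
    using *(1,2) eq by (elim disjE) (simp_all add: to_fib_def)
  with expand_inj[OF *(3,4)] show "p = q \<and> u = v" by blast
qed

lemma fib_words_eq: "fib_words n = to_fib ` params n"
proof (intro equalityI subsetI)
  fix w assume "w \<in> fib_words n"
  then have w: "set w \<subseteq> {1, 2}" "length w = n" "fib w"
    by (auto simp: fib_words_def binary_words_def fib_def)
  show "w \<in> to_fib ` params n"
  proof (cases "w = [] \<or> hd w = 2")
    case True
    then obtain u where "set u \<subseteq> {1, 2}" "w = expand u" using fib_imp_expand w by blast
    with w show ?thesis
      by (intro image_eqI[of _ _ "([], u)"]) (auto simp: params_def to_fib_def length_expand)
  next
    case False
    then obtain v where v: "w = 1 # v" using w(1) by (cases w) auto
    have "set v \<subseteq> {1, 2}" "fib v" "v = [] \<or> hd v = 2" using w v by (cases v; auto)+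
    then obtain u where "set u \<subseteq> {1, 2}" "v = expand u" using fib_imp_expand by blast
    with w v show ?thesis
      by (intro image_eqI[of _ _ "([1], u)"]) (auto simp: params_def to_fib_def length_expand)
  qed
next
  fix w assume "w \<in> to_fib ` params n"
  then obtain p u where pu: "(p, u) \<in> params n" "w = p @ expand u" by (auto simp: to_fib_def)
  have "fib w" using fib_expand_aux[of u] pu by (auto simp: params_def)
  then show "w \<in> fib_words n"
    using pu set_expand[of u]
    by (auto simp: fib_words_def binary_words_def fib_def params_def length_expand)
qed

section \<open>Excedances of binary words\<close>

lemma sort_binary_word:
  assumes "set w \<subseteq> {1, 2::nat}"
  shows "sort w = replicate (count_list w 1) 1 @ replicate (count_list w 2) 2"
  using assms
proof (induction w)
  case (Cons x w)
  have "insort 2 (replicate a 1 @ replicate b 2) = replicate a 1 @ 2 # replicate b (2::nat)" for a b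
    by (induction a) (simp_all add: replicate_append_same insort_is_Cons)
  moreover have "insort 1 (replicate a 1 @ replicate b (2::nat)) = 1 # replicate a 1 @ replicate b 2" for a b
    by (rule insort_is_Cons) auto
  ultimately show ?case using Cons by auto
qed simp

text \<open>The sorted word has its ones exactly in the first \<open>count_list w 1\<close>
  positions, and an excedance can only be a 2 over a 1.\<close>

lemma exc_binary_word:
  assumes "set w \<subseteq> {1, 2}"
  shows "exc w = count_list (take (count_list w 1) w) 2"
proof -
  let ?N = "count_list w 1"
  have len: "?N + count_list w 2 = length w" using assms by (rule count_list_one_two)
  have letter: "w ! i = 1 \<or> w ! i = 2" if "i < length w" for i
    using assms nth_mem[OF that] by auto
  have "i < length w \<and> w ! i > sort w ! i \<longleftrightarrow> i < length (take ?N w) \<and> 2 = take ?N w ! i" for i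
    using letter[of i] len unfolding eq_commute[of 2] by (auto simp: sort_binary_word[OF assms] nth_append)
  then have "exc w = length (filter ((=) 2) (take ?N w))"
    by (simp add: exc_def length_filter_conv_card)
  also have "\<dots> = count_list (take ?N w) 2"
    by (simp add: count_list_eq_length_filter)
  finally show ?thesis .
qed

section \<open>The partition of a binary word\<close>

lemma twos_left_Nil [simp]: "twos_left [] = []"
  by (simp add: twos_left_def)

lemma twos_left_snoc:
  "twos_left (w @ [x]) = twos_left w @ (if x = 1 then [count_list w 2] else [])"
  by (auto simp: twos_left_def nth_append intro!: map_cong filter_cong)

text \<open>Looking to the left makes recursion at the right end natural. This form strips prefixes
  instead: a 2 in front raises every count by one.\<close>

lemma twos_left_Cons:
  "twos_left (x # w) = (if x = 1 then [0] else []) @ map (\<lambda>c. c + count_list [x] 2) (twos_left w)"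
proof (induction w rule: rev_induct)
  case Nil
  show ?case using twos_left_snoc[of "[]" x] by simp
next
  case (snoc y w)
  then show ?case using twos_left_snoc[of "x # w" y] by (auto simp: twos_left_snoc)
qed

lemma twos_left_le: "c \<in> set (twos_left w) \<Longrightarrow> c \<le> count_list w 2"
  by (induction w rule: rev_induct) (auto simp: twos_left_snoc split: if_splits)

lemma sorted_twos_left: "sorted (twos_left w)"
  by (induction w rule: rev_induct) (auto simp: twos_left_snoc sorted_append twos_left_le)

lemma length_twos_left: "length (twos_left w) = count_list w 1"
  by (induction w rule: rev_induct) (auto simp: twos_left_snoc)

text \<open>The counts weakly increase from left to right, so sorting fixes them.\<close>

lemma word_partition_eq: "word_partition w = rev (filter (\<lambda>c. c > 0) (twos_left w))"
  by (simp add: word_partition_def sorted_sort_id sorted_filter[of id, simplified] sorted_twos_left)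

lemma twos_left_replicate_append:
  "twos_left (replicate k 2 @ u) = map (\<lambda>c. c + k) (twos_left u)"
  by (induction k) (simp_all add: twos_left_Cons)

text \<open>The first entry of \<open>twos_left w\<close> counts the twos before the first 1. For
  positive \<open>k\<close> the last hypothesis guarantees that a 1 exists, so the bound on the
  entries is not vacuous.\<close>

lemma twos_left_ge_imp_prefix:
  assumes "set w \<subseteq> {1, 2}" "\<forall>c \<in> set (twos_left w). k \<le> c" "k \<le> count_list w 1"
  shows "\<exists>u. set u \<subseteq> {1, 2} \<and> w = replicate k 2 @ u"
  using assms
proof (induction k arbitrary: w)
  case (Suc k)
  then obtain x v where w: "w = x # v" by (cases w) auto
  with Suc.prems have x: "x = 2" by (auto simp: twos_left_Cons split: if_splits)
  have "\<exists>u. set u \<subseteq> {1, 2} \<and> v = replicate k 2 @ u"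
    using Suc.prems by (intro Suc.IH) (auto simp: w x twos_left_Cons)
  with w x show ?case by auto
qed auto

text \<open>The last count is the largest; if it is 0, the partition is empty and the default value
  0 agrees with it.\<close>

lemma first_part_word_partition:
  "first_part (word_partition w) = (if twos_left w = [] then 0 else last (twos_left w))"
proof (cases "twos_left w" rule: rev_cases)
  case (snoc cs c)
  then show ?thesis
    using sorted_twos_left[of w]
    by (auto simp: first_part_def word_partition_eq sorted_append filter_empty_conv)
qed (simp add: first_part_def word_partition_eq)

lemma first_part_le:
  assumes "set w \<subseteq> {1, 2}"
  shows "int (first_part (word_partition w)) \<le> int (length w) - int (count_list w 1)"
  using count_list_one_two[OF assms] twos_left_le[of "last (twos_left w)" w]
  by (auto simp: first_part_word_partition)

text \<open>The last 1 has all twos to its left iff no 2 follows it. A nonempty word without ones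
  has first part 0 but a positive number of twos, and ends with 2.\<close>

lemma first_part_eq_iff:
  assumes "set w \<subseteq> {1, 2}" "w \<noteq> []"
  shows "int (first_part (word_partition w)) = int (length w) - int (count_list w 1) \<longleftrightarrow> last w = 1"
proof (cases w rule: rev_cases)
  case (snoc v x)
  have "twos_left v \<noteq> [] \<Longrightarrow> last (twos_left v) \<le> count_list v 2"
    by (intro twos_left_le) simp
  then show ?thesis
    using count_list_one_two[of v] assms
    by (auto simp: snoc first_part_word_partition twos_left_snoc)
qed (use assms in simp)

section \<open>The Durfee condition\<close>

text \<open>Nothing lies below the Durfee square iff its size is the full length, that is, iff
  \<open>length lam\<close> itself is admissible in the maximum. This only tests the last
  part.\<close>

lemma below_durfee_eq_Nil_iff:
  "below_durfee lam = [] \<longleftrightarrow> lam = [] \<or> length lam \<le> last lam"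
proof -
  let ?D = "{i. i \<le> length lam \<and> (i = 0 \<or> lam ! (i - 1) \<ge> i)}"
  have fin: "finite ?D" by (rule finite_subset[of _ "{..length lam}"]) auto
  have mem: "durfee lam \<in> ?D"
    unfolding durfee_def by (rule Max_in[OF fin]) auto
  have "below_durfee lam = [] \<longleftrightarrow> length lam \<le> durfee lam"
    by (simp add: below_durfee_def)
  also have "\<dots> \<longleftrightarrow> length lam \<in> ?D"
    using mem Max_ge[OF fin, of "length lam"] unfolding durfee_def by (metis (lifting) le_antisym mem_Collect_eq)
  also have "\<dots> \<longleftrightarrow> lam = [] \<or> length lam \<le> last lam"
    by (cases "lam = []") (auto simp: last_conv_nth)
  finally show ?thesis .
qed

lemma durfee_le: "durfee lam \<le> length lam"
  unfolding durfee_def by (subst Max_le_iff) (auto intro: finite_subset[of _ "{..length lam}"])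

lemma durfee_eq_length: "below_durfee lam = [] \<Longrightarrow> durfee lam = length lam"
  using durfee_le[of lam] by (simp add: below_durfee_def)

definition to_R :: "nat list \<times> nat list \<Rightarrow> nat list" where
  "to_R = (\<lambda>(p, u). p @ replicate (count_list u 1) 2 @ u)"

text \<open>Collects the conditions that \<open>R_words\<close> and \<open>R_words'\<close> share;
  they differ only in the one on the first part.\<close>

definition durfee_cond :: "nat list \<Rightarrow> bool" where
  "durfee_cond w \<longleftrightarrow> int (count_list w 1) - 1 \<le> int (durfee (word_partition w)) \<and>
    durfee (word_partition w) \<le> count_list w 1 \<and> below_durfee (word_partition w) = []"

text \<open>With an empty lower part the Durfee size is the number of positive counts, so the lower
  bound on it says that at most one count vanishes.\<close>

lemma durfee_cond_iff:
  "durfee_cond w \<longleftrightarrow> (let cs = filter (\<lambda>c. c > 0) (twos_left w) in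
     count_list w 1 \<le> Suc (length cs) \<and> (\<forall>c \<in> set cs. length cs \<le> c))"
proof -
  let ?cs = "filter (\<lambda>c. c > 0) (twos_left w)"
  have le: "length ?cs \<le> count_list w 1"
    using length_filter_le[of _ "twos_left w"] by (simp add: length_twos_left)
  have "sorted ?cs"
    using sorted_filter[of id, simplified] sorted_twos_left by blast
  then have "?cs = [] \<or> length ?cs \<le> last (rev ?cs) \<longleftrightarrow> (\<forall>c \<in> set ?cs. length ?cs \<le> c)"
    by (cases ?cs) (auto simp del: filter.simps)
  then have "below_durfee (word_partition w) = [] \<longleftrightarrow> (\<forall>c \<in> set ?cs. length ?cs \<le> c)"
    unfolding word_partition_eq below_durfee_eq_Nil_iff by simp
  then show ?thesis
    using le durfee_eq_length[of "word_partition w"]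
    by (auto simp: durfee_cond_def Let_def word_partition_eq)
qed

text \<open>The leading 1 has count 0 and uses up the single vanishing count, so all ones of
  \<open>v\<close> must yield parts.\<close>

lemma durfee_cond_Cons_one:
  "durfee_cond (1 # v) \<longleftrightarrow> (\<forall>c \<in> set (twos_left v). count_list v 1 \<le> c)"
proof -
  let ?cs = "filter (\<lambda>c. c > 0) (twos_left v)"
  have eq: "length ?cs = length (twos_left v) \<longleftrightarrow> (\<forall>c \<in> set (twos_left v). c > 0)"
    by (metis filter_True filter_id_conv length_filter_less less_irrefl)
  have le: "length ?cs \<le> count_list v 1"
    using length_filter_le[of _ "twos_left v"] by (simp add: length_twos_left)
  have pos: "count_list v 1 > 0" if "c \<in> set (twos_left v)" for c
    using that length_twos_left[of v] by (metis length_pos_if_in_set)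
  show ?thesis
  proof
    assume "durfee_cond (1 # v)"
    then have *: "count_list v 1 \<le> length ?cs" "\<forall>c \<in> set ?cs. length ?cs \<le> c"
      by (auto simp: durfee_cond_iff Let_def twos_left_Cons)
    with le eq have "\<forall>c \<in> set (twos_left v). c > 0" by (simp add: length_twos_left)
    with * show "\<forall>c \<in> set (twos_left v). count_list v 1 \<le> c" by fastforce
  next
    assume *: "\<forall>c \<in> set (twos_left v). count_list v 1 \<le> c"
    \<comment> \<open>An entry \<open>c\<close> comes from a 1 in \<open>v\<close>, so the lower
      bound \<open>count_list v 1\<close> on \<open>c\<close> is positive.\<close>
    then have "\<forall>c \<in> set (twos_left v). c > 0" using pos by fastforce
    then have "?cs = twos_left v" by (simp add: filter_id_conv)
    with * show "durfee_cond (1 # v)"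
      by (simp add: durfee_cond_iff Let_def twos_left_Cons length_twos_left)
  qed
qed

lemma durfee_cond_if_not_Cons_one:
  assumes "w = [] \<or> hd w = 2"
  shows "durfee_cond w \<longleftrightarrow> (\<forall>c \<in> set (twos_left w). count_list w 1 \<le> c)"
proof -
  have "filter (\<lambda>c. c > 0) (twos_left w) = twos_left w"
    using assms by (cases w) (auto simp: twos_left_Cons filter_id_conv)
  then show ?thesis by (simp add: durfee_cond_iff Let_def length_twos_left)
qed

section \<open>The bijection from the parameters onto \<open>R_words n\<close>\<close>

lemma count_list_to_R: "count_list (to_R (p, u)) 1 = count_list p 1 + count_list u 1"
  by (simp add: to_R_def count_list_replicate)

text \<open>Makes \<open>p\<close> recoverable from the first letter: if \<open>u\<close> contains a
  1, an inserted 2 follows \<open>p\<close>; otherwise \<open>u\<close> consists of twos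
  only.\<close>

lemma to_R_head_iff:
  assumes "set u \<subseteq> {1, 2}" "p = [] \<or> p = [1]"
  shows "to_R (p, u) = [] \<or> hd (to_R (p, u)) = 2 \<longleftrightarrow> p = []"
proof (cases "count_list u 1")
  case 0
  with assms show ?thesis by (cases u) (auto simp: to_R_def)
qed (use assms(2) in \<open>auto simp: to_R_def\<close>)

lemma durfee_cond_to_R:
  assumes "set u \<subseteq> {1, 2}" "p = [] \<or> p = [1]"
  shows "durfee_cond (to_R (p, u))"
proof -
  let ?v = "replicate (count_list u 1) 2 @ u"
  have "\<forall>c \<in> set (twos_left ?v). count_list ?v 1 \<le> c"
    by (auto simp: twos_left_replicate_append count_list_replicate)
  then show ?thesis
    using assms(2) durfee_cond_Cons_one[of ?v]
      durfee_cond_if_not_Cons_one[of ?v] to_R_head_iff[OF assms(1), of "[]"]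
    by (auto simp: to_R_def)
qed

lemma R_words_eq_durfee_cond: "R_words n = {w \<in> binary_words n. durfee_cond w}"
  using first_part_le by (auto simp: R_words_def durfee_cond_def binary_words_def Let_def)

lemma R_words'_eq:
  assumes "n > 0"
  shows "R_words' n = {w \<in> R_words n. last w = 1}"
proof -
  have "w \<in> R_words' n \<longleftrightarrow> w \<in> R_words n \<and> last w = 1" for w
  proof (cases "w \<in> binary_words n")
    case True
    then have "set w \<subseteq> {1, 2}" "w \<noteq> []" "length w = n"
      using assms by (auto simp: binary_words_def)
    with first_part_eq_iff[of w] True show ?thesis
      unfolding R_words_eq_durfee_cond by (auto simp: R_words'_def durfee_cond_def Let_def)
  qed (simp add: R_words_def R_words'_def)
  then show ?thesis by blast
qed

lemma R_words_eq: "R_words n = to_R ` params n"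
proof (intro equalityI subsetI)
  fix w assume "w \<in> R_words n"
  then have w: "set w \<subseteq> {1, 2}" "length w = n" "durfee_cond w"
    by (auto simp: R_words_eq_durfee_cond binary_words_def)
  \<comment> \<open>Both shapes of \<open>w\<close> lead to the same bound on the counts of
    \<open>v\<close>, which is what forces the block of twos.\<close>
  obtain p v where pv: "w = p @ v" "p = [] \<or> p = [1]" "set v \<subseteq> {1, 2}"
    "\<forall>c \<in> set (twos_left v). count_list v 1 \<le> c"
  proof (cases "w = [] \<or> hd w = 2")
    case True
    with w that[of "[]" w] show ?thesis by (simp add: durfee_cond_if_not_Cons_one)
  next
    case False
    then obtain v where "w = 1 # v" using w(1) by (cases w) auto
    with w that[of "[1]" v] show ?thesis using durfee_cond_Cons_one[of v] by simp
  qed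
  then obtain u where u: "set u \<subseteq> {1, 2}" "v = replicate (count_list v 1) 2 @ u"
    using twos_left_ge_imp_prefix by blast
  have "count_list v 1 = count_list u 1"
    by (subst u(2)) (simp add: count_list_replicate)
  with u pv w show "w \<in> to_R ` params n"
    by (intro image_eqI[of _ _ "(p, u)"]) (auto simp: params_def to_R_def)
next
  fix w assume "w \<in> to_R ` params n"
  then obtain p u where pu: "(p, u) \<in> params n" "w = to_R (p, u)" by auto
  then have "durfee_cond w" using durfee_cond_to_R by (auto simp: params_def)
  then show "w \<in> R_words n"
    using pu by (auto simp: R_words_eq_durfee_cond binary_words_def params_def to_R_def)
qed

text \<open>The head determines \<open>p\<close>; the total number of ones then gives that of
  \<open>u\<close>, hence the length of the inserted block, which can be cancelled.\<close>

lemma inj_on_to_R: "inj_on to_R (params n)"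
proof (rule inj_onI, clarify)
  fix p u q v
  assume *: "(p, u) \<in> params n" "(q, v) \<in> params n" "to_R (p, u) = to_R (q, v)"
  have "p = q"
    using to_R_head_iff[of u p] to_R_head_iff[of v q] *
    unfolding params_def mem_Collect_eq prod.case by metis
  moreover from this * have "count_list u 1 = count_list v 1"
    using count_list_to_R[of p u] count_list_to_R[of q v] by simp
  ultimately show "p = q \<and> u = v" using *(3) by (simp add: to_R_def)
qed

text \<open>The number of ones equals the length of \<open>p\<close> plus that of the inserted
  block, so the relevant initial segment is exactly \<open>p\<close> followed by the inserted
  twos.\<close>

lemma exc_to_R:
  assumes "set u \<subseteq> {1, 2}" "p = [] \<or> p = [1]"
  shows "exc (to_R (p, u)) = count_list u 1"
proof -
  have "set (to_R (p, u)) \<subseteq> {1, 2}" using assms by (auto simp: to_R_def)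
  from exc_binary_word[OF this] show ?thesis
    using assms(2) unfolding count_list_to_R by (auto simp: to_R_def count_list_replicate)
qed

section \<open>Comparison of the two parametrisations\<close>

lemma eulerian_pair_image:
  assumes "finite P" "inj_on f P" "inj_on g P" "\<And>x. x \<in> P \<Longrightarrow> des (f x) = exc (g x)"
  shows "eulerian_pair (f ` P) (g ` P)"
  unfolding eulerian_pair_def
proof (intro conjI allI)
  fix j :: int
  let ?Q = "{x \<in> P. int (des (f x)) = j}"
  have "{w \<in> f ` P. int (des w) = j} = f ` ?Q" "{w \<in> g ` P. int (exc w) = j} = g ` ?Q"
    using assms(4) by auto
  moreover have "inj_on f ?Q" "inj_on g ?Q"
    using assms(2,3) by (auto intro: inj_on_subset)
  ultimately show "card {w \<in> f ` P. int (des w) = j} = card {w \<in> g ` P. int (exc w) = j}"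
    by (simp add: card_image)
qed (use assms(1) in auto)

lemma des_to_fib_eq_exc_to_R: "x \<in> params n \<Longrightarrow> des (to_fib x) = exc (to_R x)"
  by (cases x) (simp add: params_def to_fib_def des_append_expand exc_to_R)

lemma last_to_fib_eq_last_to_R:
  assumes "x \<in> params n"
  shows "last (to_fib x) = last (to_R x)"
  using assms by (cases x) (auto simp: params_def to_fib_def to_R_def last_append last_expand)

theorem theorem2p1:
  fixes n :: nat
  assumes "n > 0"
  shows "eulerian_pair (fib_words n) (R_words n) \<and> eulerian_pair (fib_words' n) (R_words' n)"
proof
  show "eulerian_pair (fib_words n) (R_words n)"
    unfolding fib_words_eq R_words_eq
    using finite_params inj_on_to_fib inj_on_to_R des_to_fib_eq_exc_to_R
    by (rule eulerian_pair_image)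
next
  \<comment> \<open>Ending with 1 selects the same parameters on both sides, because the two words
    of a parameter share their last letter.\<close>
  let ?P = "{x \<in> params n. last (to_fib x) = 1}"
  \<comment> \<open>Positivity of \<open>n\<close> excludes the empty word, whose
    \<open>last\<close> is unspecified.\<close>
  have "fib_words' n = {w \<in> fib_words n. last w = 1}"
    using assms by (auto simp: fib_words'_def fib_words_def binary_words_def)
  then have "fib_words' n = to_fib ` ?P"
    by (auto simp: fib_words_eq)
  moreover have "R_words' n = to_R ` ?P"
    using R_words'_eq[OF assms] last_to_fib_eq_last_to_R by (auto simp: R_words_eq)
  moreover have "eulerian_pair (to_fib ` ?P) (to_R ` ?P)"
    using finite_params inj_on_to_fib inj_on_to_R
    by (intro eulerian_pair_image) (auto intro: inj_on_subset des_to_fib_eq_exc_to_R)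
  ultimately show "eulerian_pair (fib_words' n) (R_words' n)" by simp
qed

end
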